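(* Let $S_n\sim\mathrm{HypoXG}(\theta_1,\dots,\theta_n)$, where the unknown parameters $\theta_1,\dots,\theta_n>0$ are pairwise distinct, and let $t_1,\dots,t_N>0$ be the observed values. Then the maximum likelihood estimators $\widehat\theta_1,\dots,\widehat\theta_n$ of $\theta_1,\dots,\theta_n$ (the maximizer, over pairwise distinct positive parameters, of the likelihood $L(\theta)=\prod_{u=1}^{N}f_{S_n}(t_u)$) verify, for every $p=1,\dots,n$, the following implicit equation at $(\theta_1,\dots,\theta_n)=(\widehat\theta_1,\dots,\widehat\theta_n)$: $$\sum_{v=1}^{N}\frac{\displaystyle\frac{N(2+\theta_p)}{\theta_p(1+\theta_p)}+\sum_{u=1}^{N}\frac{\sum_{i=1}^{n}\frac{\partial}{\partial\theta_p}\left(e^{-\theta_it_u}\left(\frac{A_{i1}t_u^2}{2}+A_{i2}t_u+A_{i3}\right)\right)}{\sum_{i=1}^{n}e^{-\theta_it_u}\left(\frac{A_{i1}t_u^2}{2}+A_{i2}t_u+A_{i3}\right)}}{\displaystyle\sum_{u=1}^{N}\log K+\sum_{u=1}^{N}\log\left[\sum_{i=1}^{n}\left(\frac{A_{i1}}{\theta_i^3}\frac{\theta_i^3t_u^2e^{-\theta_it_u}}{2}+\frac{A_{i2}}{\theta_i^2}\theta_i^2t_ue^{-\theta_it_u}+\frac{A_{i3}}{\theta_i}\theta_ie^{-\theta_it_u}\right)\right]}=0,$$ where $K=\prod_{i=1}^{n}\frac{\theta_i^2}{1+\theta_i}$ and $A_{i1},A_{i2},A_{i3}$ are the functions of $\theta=(\theta_1,\dots,\theta_n)$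 given in the context.
   Context: XGamma distribution: for $\theta>0$, $X\sim \mathrm{XG}(\theta)$ means $X$ is a real random variable with density $\frac{\theta^2}{1+\theta}\left(1+\frac{\theta}{2}t^2\right)e^{-\theta t}$ for $t>0$, and $0$ otherwise. HypoXG: $S_n\sim\mathrm{HypoXG}(\theta_1,\dots,\theta_n)$ means $S_n=X_1+\cdots+X_n$ with $X_1,\dots,X_n$ independent and $X_j\sim\mathrm{XG}(\theta_j)$. Its density is denoted $f_{S_n}$ (it depends on $\theta_1,\dots,\theta_n$). For pairwise distinct $\theta_1,\dots,\theta_n>0$ and $1\le i\le n$ put $$A_{i1}=\theta_i\prod_{j\ne i}\frac{(\theta_j-\theta_i)^2+\theta_j}{(\theta_j-\theta_i)^3},\qquad A_{i2}=A_{i1}\sum_{j\neq i}\left(\frac{2(\theta_j-\theta_i)}{(\theta_j-\theta_i)^2+\theta_j}-\frac{3}{\theta_j-\theta_i}\right),$$ $$A_{i3}=\frac{A_{i1}}{2}\left(\sum_{j\ne i}\left(\frac{2(\theta_j-\theta_i)}{(\theta_j-\theta_i)^2+\theta_j}-\frac{3}{\theta_j-\theta_i}\right)\right)^{2}+\frac{A_{i1}}{2}\left(\frac{2}{\theta_i}+\sum_{j\ne i}\left(-2\,\frac{(\theta_j-\theta_i)^2-\theta_j}{\left((\theta_j-\theta_i)^2+\theta_j\right)^2}+\frac{3}{(\theta_j-\theta_i)^2}\right)\right),$$ products and sums being over $j\in\{1,\dots,n\}\setminus\{i\}$ (empty product $=1$, empty sum $=0$). *)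

theory Defs
  imports "HOL-Probability.Probability"
begin

definition xgamma_density :: "real \<Rightarrow> real \<Rightarrow> real" where
  "xgamma_density \<theta> t =
     (if t > 0 then \<theta>\<^sup>2 / (1 + \<theta>) * (1 + \<theta> / 2 * t\<^sup>2) * exp (- \<theta> * t) else 0)"

definition XG :: "real \<Rightarrow> real measure" where
  "XG \<theta> = density lborel (\<lambda>t. ennreal (xgamma_density \<theta> t))"

(* A parameter vector (theta_1, ..., theta_n) is a function nat => real of which only the
   values on {1..n} matter. *)

definition HypoXG :: "nat \<Rightarrow> (nat \<Rightarrow> real) \<Rightarrow> real measure" where
  "HypoXG n \<theta> = distr (PiM {1..n} (\<lambda>j. XG (\<theta> j))) borel (\<lambda>x. \<Sum>j=1..n. x j)"

lemma (in prob_space) distr_sum_XG: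
  fixes X :: "nat \<Rightarrow> 'a \<Rightarrow> real"
  assumes indep: "indep_vars (\<lambda>_. borel) X {1..n}"
    and XG: "\<And>j. j \<in> {1..n} \<Longrightarrow> distributed M lborel (X j) (\<lambda>t. ennreal (xgamma_density (\<theta> j) t))"
  shows "distr M borel (\<lambda>\<omega>. \<Sum>j=1..n. X j \<omega>) = HypoXG n \<theta>"
proof -
  have rv: "X j \<in> borel_measurable M" if "j \<in> {1..n}" for j
    using indep that by (auto simp: indep_vars_def)
  have law: "distr M borel (X j) = XG (\<theta> j)" if "j \<in> {1..n}" for j
  proof -
    have "distr M borel (X j) = distr M lborel (X j)"
      by (rule distr_cong) auto
    then show ?thesis
      using distributed_distr_eq_density[OF XG[OF that]] by (simp add: XG_def)
  qed
  have joint: "distr M (PiM {1..n} (\<lambda>_. borel)) (\<lambda>\<omega>. \<lambda>j\<in>{1..n}. X j \<omega>)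
      = PiM {1..n} (\<lambda>j. XG (\<theta> j))"
  proof (cases "n = 0")
    case True
    show ?thesis
      using True by (intro measure_eqI)
        (auto simp: PiM_empty emeasure_distr emeasure_space_1 restrict_def dest!: subset_singletonD)
  next
    case False
    then have "distr M (PiM {1..n} (\<lambda>_. borel)) (\<lambda>\<omega>. \<lambda>j\<in>{1..n}. X j \<omega>)
        = PiM {1..n} (\<lambda>j. distr M borel (X j))"
      using indep_vars_iff_distr_eq_PiM'[of "{1..n}" X "\<lambda>_. borel"] indep rv by auto
    also have "\<dots> = PiM {1..n} (\<lambda>j. XG (\<theta> j))"
      by (rule PiM_cong) (simp_all only: law)
    finally show ?thesis .
  qed
  have "HypoXG n \<theta> = distr M borel
      ((\<lambda>x. \<Sum>j=1..n. x j) \<circ> (\<lambda>\<omega>. \<lambda>j\<in>{1..n}. X j \<omega>))"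
    unfolding HypoXG_def joint[symmetric] by (rule distr_distr) (use rv in measurable)
  also have "\<dots> = distr M borel (\<lambda>\<omega>. \<Sum>j=1..n. X j \<omega>)"
    by (rule distr_cong) auto
  finally show ?thesis by simp
qed

(* A density is determined only up to a null set, whereas the likelihood evaluates it at
   points; the version meant is the one that is continuous on the positive half-line and
   vanishes outside it. *)

definition is_hypoXG_density :: "nat \<Rightarrow> (nat \<Rightarrow> real) \<Rightarrow> (real \<Rightarrow> real) \<Rightarrow> bool" where
  "is_hypoXG_density n \<theta> f \<longleftrightarrow>
     f \<in> borel_measurable borel \<and> (\<forall>t. 0 \<le> f t) \<and> (\<forall>t\<le>0. f t = 0) \<and>
     continuous_on {0<..} f \<and> HypoXG n \<theta> = density lborel (\<lambda>t. ennreal (f t))"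

lemma is_hypoXG_density_unique:
  assumes f: "is_hypoXG_density n \<theta> f" and g: "is_hypoXG_density n \<theta> g"
  shows "f = g"
proof
  fix t :: real
  have ae: "AE x in lborel. f x = g x"
  proof -
    have "AE x in lborel. ennreal (f x) = ennreal (g x)"
      using f g by (intro sigma_finite_measure.density_unique[OF sigma_finite_lborel])
        (simp_all add: is_hypoXG_density_def)
    then show ?thesis
    proof eventually_elim
      case (elim x)
      then show ?case using f g by (simp add: is_hypoXG_density_def)
    qed
  qed
  show "f t = g t"
  proof (cases "t \<le> 0")
    case True
    then show ?thesis using f g by (auto simp: is_hypoXG_density_def)
  next
    case False
    define U where "U = {0<..} \<inter> (\<lambda>x. f x - g x) -` (- {0})"
    have "continuous_on {0<..} (\<lambda>x. f x - g x)"
      using f g unfolding is_hypoXG_density_def by (blast intro: continuous_on_diff)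
    then have "open U"
      unfolding U_def by (rule continuous_open_preimage) (simp_all add: open_Compl)
    moreover have "AE x in lebesgue. x \<in> - U"
    proof (rule AE_completion)
      show "AE x in lborel. x \<in> - U"
        using ae by eventually_elim (simp add: U_def)
    qed
    ultimately have "t \<in> - U"
      by (intro mem_closed_if_AE_lebesgue closed_Compl)
    then show ?thesis using False by (auto simp: U_def)
  qed
qed

definition hypoXG_density :: "nat \<Rightarrow> (nat \<Rightarrow> real) \<Rightarrow> real \<Rightarrow> real" where
  "hypoXG_density n \<theta> = (THE f. is_hypoXG_density n \<theta> f)"

definition likelihood :: "nat \<Rightarrow> nat \<Rightarrow> (nat \<Rightarrow> real) \<Rightarrow> (nat \<Rightarrow> real) \<Rightarrow> real" where
  "likelihood n N t \<theta> = (\<Prod>u=1..N. hypoXG_density n \<theta> (t u))"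

definition distinct_params :: "nat \<Rightarrow> (nat \<Rightarrow> real) \<Rightarrow> bool" where
  "distinct_params n \<theta> \<longleftrightarrow> (\<forall>i\<in>{1..n}. \<theta> i > 0) \<and> inj_on \<theta> {1..n}"

definition is_MLE :: "nat \<Rightarrow> nat \<Rightarrow> (nat \<Rightarrow> real) \<Rightarrow> (nat \<Rightarrow> real) \<Rightarrow> bool" where
  "is_MLE n N t \<theta> \<longleftrightarrow> is_arg_max (likelihood n N t) (distinct_params n) \<theta>"

definition A1 :: "nat \<Rightarrow> (nat \<Rightarrow> real) \<Rightarrow> nat \<Rightarrow> real" where
  "A1 n \<theta> i = \<theta> i * (\<Prod>j\<in>{1..n} - {i}. ((\<theta> j - \<theta> i)\<^sup>2 + \<theta> j) / (\<theta> j - \<theta> i) ^ 3)"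

definition A2 :: "nat \<Rightarrow> (nat \<Rightarrow> real) \<Rightarrow> nat \<Rightarrow> real" where
  "A2 n \<theta> i = A1 n \<theta> i *
     (\<Sum>j\<in>{1..n} - {i}. 2 * (\<theta> j - \<theta> i) / ((\<theta> j - \<theta> i)\<^sup>2 + \<theta> j) - 3 / (\<theta> j - \<theta> i))"

definition A3 :: "nat \<Rightarrow> (nat \<Rightarrow> real) \<Rightarrow> nat \<Rightarrow> real" where
  "A3 n \<theta> i =
     A1 n \<theta> i / 2 *
       (\<Sum>j\<in>{1..n} - {i}. 2 * (\<theta> j - \<theta> i) / ((\<theta> j - \<theta> i)\<^sup>2 + \<theta> j) - 3 / (\<theta> j - \<theta> i))\<^sup>2
   + A1 n \<theta> i / 2 *
       (2 / \<theta> i + (\<Sum>j\<in>{1..n} - {i}.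
          - 2 * (((\<theta> j - \<theta> i)\<^sup>2 - \<theta> j) / ((\<theta> j - \<theta> i)\<^sup>2 + \<theta> j)\<^sup>2) + 3 / (\<theta> j - \<theta> i)\<^sup>2))"

definition K :: "nat \<Rightarrow> (nat \<Rightarrow> real) \<Rightarrow> real" where
  "K n \<theta> = (\<Prod>i=1..n. (\<theta> i)\<^sup>2 / (1 + \<theta> i))"

definition partial_deriv :: "nat \<Rightarrow> ((nat \<Rightarrow> real) \<Rightarrow> real) \<Rightarrow> (nat \<Rightarrow> real) \<Rightarrow> real" where
  "partial_deriv p F \<theta> = deriv (\<lambda>x. F (\<theta>(p := x))) (\<theta> p)"

end

theory Submission
  imports Defs
begin

text \<open>
  Up to the factor \<open>K\<close>, the Laplace transform of \<open>HypoXG\<close> is the product of the rational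
  functions \<open>1 / (s + \<theta>\<^sub>j) + \<theta>\<^sub>j / (s + \<theta>\<^sub>j) ^ 3\<close>, and \<open>A\<^sub>i\<^sub>1, A\<^sub>i\<^sub>2, A\<^sub>i\<^sub>3\<close> are the coefficients of its
  principal part at the triple pole \<open>- \<theta>\<^sub>i\<close>. Adding one more summand multiplies this function by one
  more factor: at an old pole the principal part is multiplied by the Taylor expansion of the new
  factor, and at the new pole the coefficients are the Taylor coefficients of the old product.
  Convolution with an XGamma density acts in exactly the same way on the exponential polynomials with
  these coefficients, so no inversion theorem is needed: the density formula follows by induction,
  and as a convolution of positive functions the density is positive on the half-line. The set of
  admissible parameters is open in each coordinate, so at a maximizer the partial derivatives of the
  log-likelihood vanish; the numerator in the claim is such a partial derivative.
\<close>

section \<open>Partial fractions\<close>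

text \<open>
  \<open>pp0 a b c\<close> is a principal part at a triple pole at \<open>0\<close>; \<open>pp0\<close>, \<open>pp1\<close>, \<open>pp2\<close> are its Taylor
  coefficients of order 0, 1, 2 at \<open>y \<noteq> 0\<close>. The factor contributed by one XGamma
  variable is \<open>pp0 \<beta> 0 1 (s + \<beta>)\<close>.
\<close>

definition pp0 :: "real \<Rightarrow> real \<Rightarrow> real \<Rightarrow> real \<Rightarrow> real" where
  "pp0 a b c y = a / y ^ 3 + b / y\<^sup>2 + c / y"

definition pp1 :: "real \<Rightarrow> real \<Rightarrow> real \<Rightarrow> real \<Rightarrow> real" where
  "pp1 a b c y = - 3 * a / y ^ 4 - 2 * b / y ^ 3 - c / y\<^sup>2"

definition pp2 :: "real \<Rightarrow> real \<Rightarrow> real \<Rightarrow> real \<Rightarrow> real" where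
  "pp2 a b c y = 6 * a / y ^ 5 + 3 * b / y ^ 4 + c / y ^ 3"

lemma DERIV_pp0:
  assumes "y \<noteq> 0"
  shows "DERIV (pp0 a b c) y :> pp1 a b c y"
  unfolding pp0_def [abs_def] pp1_def using assms
  by (auto intro!: derivative_eq_intros simp: field_simps) algebra

text \<open>The factor 2 appears because \<open>pp2\<close> is a Taylor coefficient, half the second
  derivative.\<close>

lemma DERIV_pp1:
  assumes "y \<noteq> 0"
  shows "DERIV (pp1 a b c) y :> 2 * pp2 a b c y"
  unfolding pp1_def [abs_def] pp2_def using assms
  by (auto intro!: derivative_eq_intros simp: field_simps) algebra

text \<open>With \<open>z - y\<close> fixed, both sides are rational functions of \<open>y\<close>
  that vanish at infinity and have the same principal parts: at each pole the principal part of one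
  factor is multiplied by the Taylor expansion of the other, cut off after second order.\<close>

lemma pp0_mult:
  assumes "y \<noteq> 0" "z \<noteq> 0" "y \<noteq> z"
  shows "pp0 a b c y * pp0 \<beta> 0 1 z =
    pp0 (a * pp0 \<beta> 0 1 (z - y))
        (b * pp0 \<beta> 0 1 (z - y) + a * pp1 \<beta> 0 1 (z - y))
        (c * pp0 \<beta> 0 1 (z - y) + b * pp1 \<beta> 0 1 (z - y) + a * pp2 \<beta> 0 1 (z - y)) y
    + pp0 (\<beta> * pp0 a b c (y - z)) (\<beta> * pp1 a b c (y - z))
        (\<beta> * pp2 a b c (y - z) + pp0 a b c (y - z)) z"
proof -
  \<comment> \<open>In terms of the distance \<open>x\<close> of the poles, clearing denominators
    leaves a polynomial identity once \<open>z\<close> is replaced by \<open>x + y\<close>.\<close>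
  define x where "x = z - y"
  have x: "x \<noteq> 0" "z = x + y" "y - z = - x" using assms by (auto simp: x_def)
  show ?thesis
    unfolding pp0_def pp1_def pp2_def x_def [symmetric] x(3)
    apply (simp add: field_simps x(1) assms(1,2))
    unfolding x(2)
    apply algebra
    done
qed

text \<open>The logarithmic derivative of \<open>pp0 \<beta> 0 1\<close>.\<close>

definition xg_logder :: "real \<Rightarrow> real \<Rightarrow> real" where
  "xg_logder \<beta> x = 2 * x / (x\<^sup>2 + \<beta>) - 3 / x"

definition xg_logder' :: "real \<Rightarrow> real \<Rightarrow> real" where
  "xg_logder' \<beta> x = - 2 * ((x\<^sup>2 - \<beta>) / (x\<^sup>2 + \<beta>)\<^sup>2) + 3 / x\<^sup>2"

lemma xg_pp0: "x \<noteq> 0 \<Longrightarrow> pp0 \<beta> 0 1 x = (x\<^sup>2 + \<beta>) / x ^ 3"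
  by (simp add: pp0_def field_simps) algebra

lemma xg_pp1:
  assumes "x \<noteq> 0" "\<beta> > 0"
  shows "pp1 \<beta> 0 1 x = pp0 \<beta> 0 1 x * xg_logder \<beta> x"
proof -
  define w where "w = x\<^sup>2 + \<beta>"
  have nz: "w \<noteq> 0" using assms unfolding w_def by (smt (verit) zero_le_power2)
  have b: "\<beta> = w - x\<^sup>2" by (simp add: w_def)
  show ?thesis
    unfolding xg_pp0[OF assms(1)] pp1_def xg_logder_def w_def[symmetric]
    unfolding b
    by (simp add: divide_simps nz assms) (simp add: algebra_simps power_numeral_reduce)
qed

text \<open>A function \<open>f\<close> with logarithmic derivative \<open>g\<close> has second
  derivative \<open>f * (g^2 + g')\<close>, and \<open>pp2\<close> is half of it.\<close>

lemma xg_pp2: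
  assumes "x \<noteq> 0" "\<beta> > 0"
  shows "2 * pp2 \<beta> 0 1 x = pp0 \<beta> 0 1 x * ((xg_logder \<beta> x)\<^sup>2 + xg_logder' \<beta> x)"
proof -
  define w where "w = x\<^sup>2 + \<beta>"
  have nz: "w \<noteq> 0" using assms unfolding w_def by (smt (verit) zero_le_power2)
  have b: "\<beta> = w - x\<^sup>2" by (simp add: w_def)
  show ?thesis
    unfolding xg_pp0[OF assms(1)] pp2_def xg_logder_def xg_logder'_def w_def[symmetric]
    unfolding b
    by (simp add: field_simps nz assms) algebra
qed

lemma DERIV_xg_logder:
  assumes "x \<noteq> 0" "\<beta> > 0"
  shows "DERIV (xg_logder \<beta>) x :> xg_logder' \<beta> x"
proof -
  have nz: "x\<^sup>2 + \<beta> \<noteq> 0" using assms by (smt (verit) zero_le_power2)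
  show ?thesis
    unfolding xg_logder_def [abs_def] xg_logder'_def using assms nz
    by (auto intro!: derivative_eq_intros simp: power2_eq_square diff_divide_distrib add_divide_distrib)
qed

section \<open>Coefficients through logarithmic derivatives, and their recursion\<close>

definition logder_sum :: "nat \<Rightarrow> (nat \<Rightarrow> real) \<Rightarrow> nat \<Rightarrow> real" where
  "logder_sum n \<theta> i = (\<Sum>j\<in>{1..n} - {i}. xg_logder (\<theta> j) (\<theta> j - \<theta> i))"

text \<open>At \<open>s = - \<theta> i\<close> one has
  \<open>s + \<theta> j = \<theta> j - \<theta> i\<close>, so the two sums are the logarithmic
  derivative, at this pole, of the product of the other factors, and the derivative of that.\<close>

definition logder_sum' :: "nat \<Rightarrow> (nat \<Rightarrow> real) \<Rightarrow> nat \<Rightarrow> real" where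
  "logder_sum' n \<theta> i = (\<Sum>j\<in>{1..n} - {i}. xg_logder' (\<theta> j) (\<theta> j - \<theta> i))"

lemma distinct_params_Suc: "distinct_params (Suc n) \<theta> \<Longrightarrow> distinct_params n \<theta>"
  by (auto simp: distinct_params_def intro: inj_on_subset)

lemma distinct_paramsD:
  assumes "distinct_params n \<theta>"
  shows "i \<in> {1..n} \<Longrightarrow> \<theta> i > 0"
    and "i \<in> {1..n} \<Longrightarrow> j \<in> {1..n} \<Longrightarrow> i \<noteq> j \<Longrightarrow> \<theta> i \<noteq> \<theta> j"
  using assms by (auto simp: distinct_params_def dest: inj_onD)

lemma A1_eq:
  assumes "distinct_params n \<theta>" "i \<in> {1..n}"
  shows "A1 n \<theta> i = \<theta> i * (\<Prod>j\<in>{1..n} - {i}. pp0 (\<theta> j) 0 1 (\<theta> j - \<theta> i))"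
  unfolding A1_def using distinct_paramsD(2)[OF assms(1)] assms(2)
  by (intro arg_cong2[where f="(*)"] refl prod.cong) (auto simp: xg_pp0)

lemma A2_eq: "A2 n \<theta> i = A1 n \<theta> i * logder_sum n \<theta> i"
  by (simp add: A2_def logder_sum_def xg_logder_def)

text \<open>The factor with the pole is \<open>\<theta> i / y^3 + 1 / y\<close> for
  \<open>y = s + \<theta> i\<close>. Its cubic term meets the second Taylor coefficient of the other
  factors; its simple term meets their value \<open>A1 n \<theta> i / \<theta> i\<close>, whence the
  summand \<open>2 / \<theta> i\<close>.\<close>

lemma A3_eq: "A3 n \<theta> i = A1 n \<theta> i / 2 * ((logder_sum n \<theta> i)\<^sup>2 + (2 / \<theta> i + logder_sum' n \<theta> i))"
  by (simp only: A3_def logder_sum_def xg_logder_def logder_sum'_def xg_logder'_def distrib_left)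

text \<open>The new factor is regular at the old pole, so its Taylor expansion multiplies the
  principal part. The logarithmic derivatives gain one summand each; \<open>xg_pp1\<close> and
  \<open>xg_pp2\<close> translate between the two views.\<close>

lemma A_Suc_old_pole:
  assumes d: "distinct_params (Suc n) \<theta>" and i: "i \<in> {1..n}"
  defines "\<beta> \<equiv> \<theta> (Suc n)" and "x \<equiv> \<theta> (Suc n) - \<theta> i"
  shows "A1 (Suc n) \<theta> i = A1 n \<theta> i * pp0 \<beta> 0 1 x"
    and "A2 (Suc n) \<theta> i = A2 n \<theta> i * pp0 \<beta> 0 1 x + A1 n \<theta> i * pp1 \<beta> 0 1 x"
    and "A3 (Suc n) \<theta> i =
      A3 n \<theta> i * pp0 \<beta> 0 1 x + A2 n \<theta> i * pp1 \<beta> 0 1 x + A1 n \<theta> i * pp2 \<beta> 0 1 x"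
proof -
  have set: "{1..Suc n} - {i} = insert (Suc n) ({1..n} - {i})" and "Suc n \<notin> {1..n} - {i}"
    using i by auto
  have x: "x \<noteq> 0" and \<beta>: "\<beta> > 0"
    using distinct_paramsD[OF d] i by (auto simp: x_def \<beta>_def)
  note pp = xg_pp1[OF x \<beta>] xg_pp2[OF x \<beta>]
  have S: "logder_sum (Suc n) \<theta> i = xg_logder \<beta> x + logder_sum n \<theta> i"
    and S': "logder_sum' (Suc n) \<theta> i = xg_logder' \<beta> x + logder_sum' n \<theta> i"
    unfolding logder_sum_def logder_sum'_def set by (simp_all add: \<beta>_def x_def)
  show 1: "A1 (Suc n) \<theta> i = A1 n \<theta> i * pp0 \<beta> 0 1 x"
    using i x unfolding A1_def set by (simp add: \<beta>_def x_def xg_pp0)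
  show "A2 (Suc n) \<theta> i = A2 n \<theta> i * pp0 \<beta> 0 1 x + A1 n \<theta> i * pp1 \<beta> 0 1 x"
    unfolding A2_eq 1 S pp by (simp add: algebra_simps)
  have pp2: "pp2 \<beta> 0 1 x = pp0 \<beta> 0 1 x * ((xg_logder \<beta> x)\<^sup>2 + xg_logder' \<beta> x) / 2"
    using pp(2) by simp
  show "A3 (Suc n) \<theta> i =
      A3 n \<theta> i * pp0 \<beta> 0 1 x + A2 n \<theta> i * pp1 \<beta> 0 1 x + A1 n \<theta> i * pp2 \<beta> 0 1 x"
    unfolding A2_eq A3_eq 1 S S' pp(1) pp2 by (simp add: field_simps power2_eq_square)
qed

section \<open>The product of the factors and its partial fractions\<close>

definition xg_laplace_prod :: "nat \<Rightarrow> (nat \<Rightarrow> real) \<Rightarrow> real \<Rightarrow> real" where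
  "xg_laplace_prod n \<theta> s = (\<Prod>j=1..n. pp0 (\<theta> j) 0 1 (s + \<theta> j))"

lemma DERIV_xg_laplace_prod:
  assumes pos: "\<And>j. j \<in> {1..n} \<Longrightarrow> \<theta> j > 0" and nz: "\<And>j. j \<in> {1..n} \<Longrightarrow> s + \<theta> j \<noteq> 0"
  shows "DERIV (xg_laplace_prod n \<theta>) s :>
    xg_laplace_prod n \<theta> s * (\<Sum>j=1..n. xg_logder (\<theta> j) (s + \<theta> j))"
proof -
  define f where "f j u = pp0 (\<theta> j) 0 1 (u + \<theta> j)" for j u
  \<comment> \<open>A factor could vanish only where \<open>x\<^sup>2 + \<beta> = 0\<close>, which
    \<open>\<beta> > 0\<close> excludes; so the product rule may divide by it.\<close>
  have f0: "f j s \<noteq> 0" if "j \<in> {1..n}" for j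
    using nz[OF that] pos[OF that] by (simp add: f_def xg_pp0 add_nonneg_eq_0_iff)
  have f': "(f j has_field_derivative f j s * xg_logder (\<theta> j) (s + \<theta> j)) (at s)"
    if "j \<in> {1..n}" for j
    unfolding f_def
    by (rule DERIV_cong[OF DERIV_chain2[OF DERIV_pp0]])
      (use nz[OF that] pos[OF that] in \<open>auto intro!: derivative_eq_intros simp: xg_pp1\<close>)
  have "DERIV (\<lambda>u. \<Prod>j=1..n. f j u) s :>
      (\<Prod>j=1..n. f j s) * (\<Sum>j=1..n. f j s * xg_logder (\<theta> j) (s + \<theta> j) / f j s)"
    by (rule has_field_derivative_prod'[OF f0 f']) auto
  also have "(\<Sum>j=1..n. f j s * xg_logder (\<theta> j) (s + \<theta> j) / f j s) =
      (\<Sum>j=1..n. xg_logder (\<theta> j) (s + \<theta> j))"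
    by (rule sum.cong) (use f0 in auto)
  finally show ?thesis by (simp add: f_def xg_laplace_prod_def [abs_def])
qed

definition partial_fractions :: "nat \<Rightarrow> (nat \<Rightarrow> real) \<Rightarrow> real \<Rightarrow> real" where
  "partial_fractions n \<theta> s = (\<Sum>i=1..n. pp0 (A1 n \<theta> i) (A2 n \<theta> i) (A3 n \<theta> i) (s + \<theta> i))"

text \<open>The partial fractions of the old product, differentiated twice at the new pole.\<close>

lemma A_Suc_new_pole:
  assumes d: "distinct_params (Suc n) \<theta>"
    and pf: "\<forall>s. (\<forall>i\<in>{1..n}. s + \<theta> i \<noteq> 0) \<longrightarrow>
      xg_laplace_prod n \<theta> s = partial_fractions n \<theta> s"
  defines "\<beta> \<equiv> \<theta> (Suc n)"
  defines "\<sigma>0 \<equiv> \<Sum>i=1..n. pp0 (A1 n \<theta> i) (A2 n \<theta> i) (A3 n \<theta> i) (\<theta> i - \<beta>)"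
    and "\<sigma>1 \<equiv> \<Sum>i=1..n. pp1 (A1 n \<theta> i) (A2 n \<theta> i) (A3 n \<theta> i) (\<theta> i - \<beta>)"
    and "\<sigma>2 \<equiv> \<Sum>i=1..n. pp2 (A1 n \<theta> i) (A2 n \<theta> i) (A3 n \<theta> i) (\<theta> i - \<beta>)"
  shows "A1 (Suc n) \<theta> (Suc n) = \<beta> * \<sigma>0"
    and "A2 (Suc n) \<theta> (Suc n) = \<beta> * \<sigma>1"
    and "A3 (Suc n) \<theta> (Suc n) = \<beta> * \<sigma>2 + \<sigma>0"
proof -
  have pos: "\<And>j. j \<in> {1..n} \<Longrightarrow> \<theta> j > 0" and \<beta>: "\<beta> > 0"
    and ne: "\<And>j. j \<in> {1..n} \<Longrightarrow> \<theta> j \<noteq> \<beta>"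
    using distinct_paramsD[OF d] by (auto simp: \<beta>_def)
  have set: "{1..Suc n} - {Suc n} = {1..n}" by auto
  \<comment> \<open>The line without the old poles is open, so the identity \<open>pf\<close> can be
    differentiated on it; it contains the new pole \<open>- \<beta>\<close>.\<close>
  define U where "U = - (\<lambda>i. - \<theta> i) ` {1..n}"
  have U: "open U" unfolding U_def by (intro open_Compl finite_imp_closed) auto
  have Unz: "s + \<theta> i \<noteq> 0" if "s \<in> U" "i \<in> {1..n}" for s i
    using that by (force simp: U_def add_eq_0_iff2)
  have \<beta>U: "- \<beta> \<in> U" using ne by (fastforce simp: U_def)
  let ?P = "xg_laplace_prod n \<theta>"
  define S where "S s = (\<Sum>j=1..n. xg_logder (\<theta> j) (s + \<theta> j))" for s
  define S' where "S' s = (\<Sum>j=1..n. xg_logder' (\<theta> j) (s + \<theta> j))" for s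
  define g1 where "g1 s = (\<Sum>i=1..n. pp1 (A1 n \<theta> i) (A2 n \<theta> i) (A3 n \<theta> i) (s + \<theta> i))" for s
  define g2 where "g2 s = (\<Sum>i=1..n. pp2 (A1 n \<theta> i) (A2 n \<theta> i) (A3 n \<theta> i) (s + \<theta> i))" for s
  have P': "DERIV ?P s :> ?P s * S s" if "s \<in> U" for s
    unfolding S_def by (rule DERIV_xg_laplace_prod) (use pos Unz that in auto)
  have "DERIV (partial_fractions n \<theta>) s :> g1 s" if "s \<in> U" for s
    unfolding partial_fractions_def g1_def
    by (rule DERIV_sum, rule DERIV_cong[OF DERIV_chain2[OF DERIV_pp0]])
      (use Unz[OF that] in \<open>auto intro!: derivative_eq_intros\<close>)
  then have "DERIV ?P s :> g1 s" if "s \<in> U" for s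
    using that by (rule has_field_derivative_transform_within_open[OF _ U])
      (use pf Unz that in auto)
  \<comment> \<open>Factorwise and termwise differentiation of the same function agree; the second
    derivatives are compared in the same way below.\<close>
  then have g1: "?P s * S s = g1 s" if "s \<in> U" for s
    using P' that by (blast intro: DERIV_unique)
  have "DERIV g1 s :> 2 * g2 s" if "s \<in> U" for s
    unfolding g1_def g2_def sum_distrib_left
    by (rule DERIV_sum, rule DERIV_cong[OF DERIV_chain2[OF DERIV_pp1]])
      (use Unz[OF that] in \<open>auto intro!: derivative_eq_intros\<close>)
  then have "DERIV (\<lambda>s. ?P s * S s) s :> 2 * g2 s" if "s \<in> U" for s
    using that by (rule has_field_derivative_transform_within_open[OF _ U])
      (use g1 that in auto)
  moreover have "DERIV S s :> S' s" if "s \<in> U" for s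
    unfolding S_def S'_def
    by (rule DERIV_sum, rule DERIV_cong[OF DERIV_chain2[OF DERIV_xg_logder]])
      (use Unz[OF that] pos in \<open>auto intro!: derivative_eq_intros\<close>)
  ultimately have g2: "2 * g2 s = ?P s * ((S s)\<^sup>2 + S' s)" if "s \<in> U" for s
    using DERIV_unique[OF _ DERIV_mult[OF P' \<open>\<And>s. s \<in> U \<Longrightarrow> DERIV S s :> S' s\<close>]] that
    by (simp add: algebra_simps power2_eq_square)
  have \<sigma>: "\<sigma>0 = ?P (- \<beta>)" "\<sigma>1 = g1 (- \<beta>)" "\<sigma>2 = g2 (- \<beta>)"
    using pf[rule_format, of "- \<beta>"] ne
    by (auto simp: \<sigma>0_def \<sigma>1_def \<sigma>2_def partial_fractions_def g1_def g2_def)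
  have SS: "logder_sum (Suc n) \<theta> (Suc n) = S (- \<beta>)" "logder_sum' (Suc n) \<theta> (Suc n) = S' (- \<beta>)"
    unfolding logder_sum_def logder_sum'_def set S_def S'_def by (simp_all add: \<beta>_def)
  show 1: "A1 (Suc n) \<theta> (Suc n) = \<beta> * \<sigma>0"
    unfolding A1_eq[OF d, of "Suc n", simplified] set \<sigma> xg_laplace_prod_def
    by (simp add: \<beta>_def atLeastAtMostSuc_conv set[simplified])
  show "A2 (Suc n) \<theta> (Suc n) = \<beta> * \<sigma>1"
    unfolding A2_eq 1 SS \<sigma> g1[OF \<beta>U, symmetric] by simp
  have "g2 (- \<beta>) = ?P (- \<beta>) * ((S (- \<beta>))\<^sup>2 + S' (- \<beta>)) / 2"
    using g2[OF \<beta>U] by simp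
  \<comment> \<open>The summand \<open>2 / \<beta>\<close> in \<open>A3\<close> contributes
    \<open>\<sigma>0\<close>, because \<open>A1\<close> is
    \<open>\<beta> * \<sigma>0\<close>.\<close>
  then show "A3 (Suc n) \<theta> (Suc n) = \<beta> * \<sigma>2 + \<sigma>0"
    unfolding A3_eq 1 SS \<sigma> using \<beta> by (simp add: \<beta>_def [symmetric] field_simps)
qed

text \<open>Factors are added one at a time: \<open>pp0_mult\<close> splits each product into parts
  at the old and the new pole, and the two recursions identify the coefficients. The induction
  starts at 1, since for \<open>n = 0\<close> the empty product is 1 but the empty sum is 0.\<close>

lemma partial_fraction_decomposition:
  assumes "distinct_params n \<theta>" "n \<ge> 1" "\<And>i. i \<in> {1..n} \<Longrightarrow> s + \<theta> i \<noteq> 0"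
  shows "xg_laplace_prod n \<theta> s = partial_fractions n \<theta> s"
  using assms(2,1,3)
proof (induction n arbitrary: s rule: dec_induct)
  \<comment> \<open>For a single factor the coefficients are \<open>\<theta> 1\<close>, 0 and
    1.\<close>
  case base
  then show ?case
    by (auto simp: xg_laplace_prod_def partial_fractions_def A1_def A2_def A3_def
        distinct_params_def)
next
  case (step n)
  note d = step.prems(1)
  define \<beta> where "\<beta> = \<theta> (Suc n)"
  have pf: "\<forall>s. (\<forall>i\<in>{1..n}. s + \<theta> i \<noteq> 0) \<longrightarrow>
      xg_laplace_prod n \<theta> s = partial_fractions n \<theta> s"
    using step.IH distinct_params_Suc[OF d] by blast
  let ?a = "A1 n \<theta>" and ?b = "A2 n \<theta>" and ?c = "A3 n \<theta>"
  have lin: "(\<Sum>i=1..n. pp0 (u i) (v i) (w i) z) =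
      pp0 (\<Sum>i=1..n. u i) (\<Sum>i=1..n. v i) (\<Sum>i=1..n. w i) z" for u v w z
    by (simp add: pp0_def sum.distrib sum_divide_distrib)
  have "xg_laplace_prod (Suc n) \<theta> s = xg_laplace_prod n \<theta> s * pp0 \<beta> 0 1 (s + \<beta>)"
    by (simp add: xg_laplace_prod_def \<beta>_def)
  also have "\<dots> = (\<Sum>i=1..n. pp0 (?a i) (?b i) (?c i) (s + \<theta> i) * pp0 \<beta> 0 1 (s + \<beta>))"
    using pf step.prems by (simp add: partial_fractions_def sum_distrib_right)
  also have "\<dots> = (\<Sum>i=1..n. pp0 (A1 (Suc n) \<theta> i) (A2 (Suc n) \<theta> i) (A3 (Suc n) \<theta> i) (s + \<theta> i)
     + pp0 (\<beta> * pp0 (?a i) (?b i) (?c i) (\<theta> i - \<beta>)) (\<beta> * pp1 (?a i) (?b i) (?c i) (\<theta> i - \<beta>))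
        (\<beta> * pp2 (?a i) (?b i) (?c i) (\<theta> i - \<beta>) + pp0 (?a i) (?b i) (?c i) (\<theta> i - \<beta>)) (s + \<beta>))"
  proof (rule sum.cong[OF refl])
    fix i assume i: "i \<in> {1..n}"
    then have "s + \<theta> i \<noteq> 0" "s + \<beta> \<noteq> 0" "s + \<theta> i \<noteq> s + \<beta>"
      using step.prems(2)[of i] step.prems(2)[of "Suc n"] distinct_paramsD(2)[OF d, of i "Suc n"]
      by (auto simp: \<beta>_def)
    from pp0_mult[OF this, of "?a i" "?b i" "?c i" \<beta>] A_Suc_old_pole[OF d i]
    show "pp0 (?a i) (?b i) (?c i) (s + \<theta> i) * pp0 \<beta> 0 1 (s + \<beta>) =
      pp0 (A1 (Suc n) \<theta> i) (A2 (Suc n) \<theta> i) (A3 (Suc n) \<theta> i) (s + \<theta> i)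
     + pp0 (\<beta> * pp0 (?a i) (?b i) (?c i) (\<theta> i - \<beta>)) (\<beta> * pp1 (?a i) (?b i) (?c i) (\<theta> i - \<beta>))
        (\<beta> * pp2 (?a i) (?b i) (?c i) (\<theta> i - \<beta>) + pp0 (?a i) (?b i) (?c i) (\<theta> i - \<beta>)) (s + \<beta>)"
      by (simp add: \<beta>_def)
  qed
  also have "\<dots> = partial_fractions (Suc n) \<theta> s"
    unfolding sum.distrib lin partial_fractions_def sum.cl_ivl_Suc
      A_Suc_new_pole[OF d pf, folded \<beta>_def]
    by (simp add: sum_distrib_left \<beta>_def [symmetric])
  finally show ?case .
qed

section \<open>Convolution with an XGamma density\<close>

definition xg_kernel :: "real \<Rightarrow> real \<Rightarrow> real" where
  "xg_kernel \<beta> u = exp (- \<beta> * u) * (1 + \<beta> / 2 * u\<^sup>2)"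

text \<open>The inverse Laplace transform of \<open>pp0 a b c (s + \<alpha>)\<close>;
  \<open>xg_kernel \<beta>\<close> is the case \<open>exp_poly \<beta> 0 1 \<beta>\<close>.\<close>

definition exp_poly :: "real \<Rightarrow> real \<Rightarrow> real \<Rightarrow> real \<Rightarrow> real \<Rightarrow> real" where
  "exp_poly a b c \<alpha> t = exp (- \<alpha> * t) * (a * t\<^sup>2 / 2 + b * t + c)"

text \<open>The counterpart of \<open>pp0_mult\<close>, with the same coefficients. Giving a
  primitive rather than an integral serves two purposes: the fundamental theorem of calculus for the
  density, and monotonicity for its positivity.\<close>

lemma exp_poly_convolution:
  fixes a b c \<alpha> \<beta> t :: real
  assumes "\<alpha> \<noteq> \<beta>"
  shows "\<exists>F. (\<forall>u. DERIV F u :> exp_poly a b c \<alpha> (t - u) * xg_kernel \<beta> u) \<and>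
    F t - F 0 =
      exp_poly (a * pp0 \<beta> 0 1 (\<beta> - \<alpha>))
        (b * pp0 \<beta> 0 1 (\<beta> - \<alpha>) + a * pp1 \<beta> 0 1 (\<beta> - \<alpha>))
        (c * pp0 \<beta> 0 1 (\<beta> - \<alpha>) + b * pp1 \<beta> 0 1 (\<beta> - \<alpha>) + a * pp2 \<beta> 0 1 (\<beta> - \<alpha>)) \<alpha> t
    + exp_poly (\<beta> * pp0 a b c (\<alpha> - \<beta>)) (\<beta> * pp1 a b c (\<alpha> - \<beta>))
        (\<beta> * pp2 a b c (\<alpha> - \<beta>) + pp0 a b c (\<alpha> - \<beta>)) \<beta> t"
proof -
  define x where "x = \<beta> - \<alpha>"
  have x: "x \<noteq> 0" "\<alpha> - \<beta> = - x" "\<alpha> = \<beta> - x" using assms by (auto simp: x_def)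
  define q0 where "q0 u = a * (t - u)\<^sup>2 / 2 + b * (t - u) + c" for u
  define q1 where "q1 u = - a * (t - u) - b" for u
  define h0 where "h0 u = 1 + \<beta> / 2 * u\<^sup>2" for u
  define h1 where "h1 u = \<beta> * u" for u
  txt \<open>Repeated integration by parts gives the primitive \<open>F\<close>: \<open>Q\<close> is the sum of the derivatives
    of \<open>q0 * h0\<close> of order \<open>k\<close> divided by \<open>x ^ (k + 1)\<close>.\<close>
  define Q where "Q u = q0 u * h0 u / x + (q1 u * h0 u + q0 u * h1 u) / x\<^sup>2
      + (a * h0 u + 2 * q1 u * h1 u + q0 u * \<beta>) / x ^ 3
      + (3 * a * h1 u + 3 * q1 u * \<beta>) / x ^ 4 + 6 * a * \<beta> / x ^ 5" for u
  define Q' where "Q' u = (q1 u * h0 u + q0 u * h1 u) / x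
      + (a * h0 u + 2 * q1 u * h1 u + q0 u * \<beta>) / x\<^sup>2
      + (3 * a * h1 u + 3 * q1 u * \<beta>) / x ^ 3 + 6 * a * \<beta> / x ^ 4" for u
  define F where "F u = - (exp (- \<alpha> * (t - u) - \<beta> * u) * Q u)" for u
  define r where "r = inverse x"
  have r: "z / x = z * r" "z / x ^ k = z * r ^ k" "z / - x = z * - r" "z / (- x) ^ k = z * (- r) ^ k"
    for z k
    by (simp_all add: r_def divide_inverse power_inverse flip: inverse_minus_eq)
  have q0: "DERIV q0 u :> q1 u" for u
    unfolding q0_def [abs_def] q1_def by (auto intro!: derivative_eq_intros simp: field_simps)
  have q1: "DERIV q1 u :> a" for u
    unfolding q1_def [abs_def] by (auto intro!: derivative_eq_intros)
  have h0: "DERIV h0 u :> h1 u" for u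
    unfolding h0_def [abs_def] h1_def by (auto intro!: derivative_eq_intros)
  have h1: "DERIV h1 u :> \<beta>" for u
    unfolding h1_def [abs_def] by (auto intro!: derivative_eq_intros)
  have Q: "DERIV Q u :> Q' u" for u
    unfolding Q_def [abs_def] Q'_def r
    by (rule derivative_eq_intros q0 q1 h0 h1 refl)+ algebra
  \<comment> \<open>The sums telescope: \<open>q0 * h0\<close> has degree at most 4 in
    \<open>u\<close>, so no fifth derivative remains.\<close>
  have Qx: "x * Q u - Q' u = q0 u * h0 u" for u
  proof -
    have "x * r = 1" using x by (simp add: r_def)
    then show ?thesis unfolding Q_def Q'_def r by algebra
  qed
  have "DERIV F u :> exp_poly a b c \<alpha> (t - u) * xg_kernel \<beta> u" for u
  proof -
    have "DERIV F u :> - (exp (- \<alpha> * (t - u) - \<beta> * u) * (\<alpha> - \<beta>) * Q u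
        + exp (- \<alpha> * (t - u) - \<beta> * u) * Q' u)"
      unfolding F_def [abs_def] by (auto intro!: derivative_eq_intros Q simp: algebra_simps)
    also have "- (exp (- \<alpha> * (t - u) - \<beta> * u) * (\<alpha> - \<beta>) * Q u
        + exp (- \<alpha> * (t - u) - \<beta> * u) * Q' u) = exp (- \<alpha> * (t - u) - \<beta> * u) * (x * Q u - Q' u)"
      unfolding x(2) by (simp add: algebra_simps)
    also have "exp (- \<alpha> * (t - u) - \<beta> * u) = exp (- \<alpha> * (t - u)) * exp (- \<beta> * u)"
      by (simp add: exp_add [symmetric])
    finally show ?thesis
      unfolding Qx exp_poly_def xg_kernel_def q0_def h0_def by (simp only: mult_ac)
  qed
  \<comment> \<open>At \<open>u = 0\<close> only the exponent \<open>- \<alpha> * t\<close> is left,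
    at \<open>u = t\<close> only \<open>- \<beta> * t\<close>. The values of \<open>Q\<close> there
    are polynomials in \<open>t\<close>, whose coefficients are matched next.\<close>
  moreover have "F t - F 0 = exp (- \<alpha> * t) * Q 0 + exp (- \<beta> * t) * (- Q t)"
    by (simp add: F_def)
  moreover have "Q 0 = a * pp0 \<beta> 0 1 x * t\<^sup>2 / 2 + (b * pp0 \<beta> 0 1 x + a * pp1 \<beta> 0 1 x) * t
      + (c * pp0 \<beta> 0 1 x + b * pp1 \<beta> 0 1 x + a * pp2 \<beta> 0 1 x)"
    unfolding Q_def q0_def q1_def h0_def h1_def pp0_def pp1_def pp2_def
    unfolding r by (simp add: algebra_simps power2_eq_square power_numeral_reduce)
  moreover have "- Q t = \<beta> * pp0 a b c (- x) * t\<^sup>2 / 2 + \<beta> * pp1 a b c (- x) * t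
      + (\<beta> * pp2 a b c (- x) + pp0 a b c (- x))"
    unfolding Q_def q0_def q1_def h0_def h1_def pp0_def pp1_def pp2_def
    unfolding r by (simp add: field_simps power2_eq_square power_numeral_reduce)
  ultimately show ?thesis
    unfolding x(2) x_def [symmetric] exp_poly_def by auto
qed

section \<open>The density up to the factor \<open>K\<close>\<close>

definition hypoXG_sum :: "nat \<Rightarrow> (nat \<Rightarrow> real) \<Rightarrow> real \<Rightarrow> real" where
  "hypoXG_sum n \<theta> t =
    (\<Sum>i=1..n. exp (- \<theta> i * t) * (A1 n \<theta> i * t\<^sup>2 / 2 + A2 n \<theta> i * t + A3 n \<theta> i))"

text \<open>For \<open>\<theta> 1 = 0\<close> the convention \<open>2 / 0 = 0\<close> makes all
  three coefficients vanish, hence the case distinction.\<close>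

lemma hypoXG_sum_1: "hypoXG_sum 1 \<theta> t = (if \<theta> 1 = 0 then 0 else xg_kernel (\<theta> 1) t)"
  by (simp add: hypoXG_sum_def xg_kernel_def A1_def A2_def A3_def)

text \<open>The terms are convolved one by one: each yields the updated term at its own pole and a
  remainder at the new pole, and the remainders add up to the one new term.\<close>

lemma hypoXG_sum_convolution:
  assumes d: "distinct_params (Suc n) \<theta>" and n: "n \<ge> 1"
  shows "\<exists>G. (\<forall>u. DERIV G u :> hypoXG_sum n \<theta> (t - u) * xg_kernel (\<theta> (Suc n)) u) \<and>
    G t - G 0 = hypoXG_sum (Suc n) \<theta> t"
proof -
  let ?a = "A1 n \<theta>" and ?b = "A2 n \<theta>" and ?c = "A3 n \<theta>"
  define \<beta> where "\<beta> = \<theta> (Suc n)"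
  define R where "R i = exp_poly (\<beta> * pp0 (?a i) (?b i) (?c i) (\<theta> i - \<beta>))
      (\<beta> * pp1 (?a i) (?b i) (?c i) (\<theta> i - \<beta>))
      (\<beta> * pp2 (?a i) (?b i) (?c i) (\<theta> i - \<beta>) + pp0 (?a i) (?b i) (?c i) (\<theta> i - \<beta>)) \<beta> t" for i
  have "\<exists>F. (\<forall>u. DERIV F u :> exp_poly (?a i) (?b i) (?c i) (\<theta> i) (t - u) * xg_kernel \<beta> u) \<and>
      F t - F 0 = exp_poly (A1 (Suc n) \<theta> i) (A2 (Suc n) \<theta> i) (A3 (Suc n) \<theta> i) (\<theta> i) t + R i"
    if i: "i \<in> {1..n}" for i
  proof -
    have "\<theta> i \<noteq> \<beta>"
      using distinct_paramsD(2)[OF d, of i "Suc n"] i by (auto simp: \<beta>_def)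
    from exp_poly_convolution[OF this, of "?a i" "?b i" "?c i" t] show ?thesis
      unfolding A_Suc_old_pole[OF d i] R_def \<beta>_def .
  qed
  then obtain F where F: "\<And>i u. i \<in> {1..n} \<Longrightarrow>
        DERIV (F i) u :> exp_poly (?a i) (?b i) (?c i) (\<theta> i) (t - u) * xg_kernel \<beta> u"
      "\<And>i. i \<in> {1..n} \<Longrightarrow> F i t - F i 0 =
        exp_poly (A1 (Suc n) \<theta> i) (A2 (Suc n) \<theta> i) (A3 (Suc n) \<theta> i) (\<theta> i) t + R i"
    by metis
  \<comment> \<open>The partial fractions enter here: through \<open>A_Suc_new_pole\<close> they
    evaluate the sums of the remainder coefficients.\<close>
  have pf: "\<forall>s. (\<forall>i\<in>{1..n}. s + \<theta> i \<noteq> 0) \<longrightarrow>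
      xg_laplace_prod n \<theta> s = partial_fractions n \<theta> s"
    using partial_fraction_decomposition[OF distinct_params_Suc[OF d] n] by blast
  have lin: "(\<Sum>i=1..n. exp_poly (u i) (v i) (w i) \<beta> t) =
      exp_poly (\<Sum>i=1..n. u i) (\<Sum>i=1..n. v i) (\<Sum>i=1..n. w i) \<beta> t" for u v w
    by (simp add: exp_poly_def sum.distrib sum_divide_distrib sum_distrib_left sum_distrib_right
        distrib_left)
  have R: "(\<Sum>i=1..n. R i) = exp_poly (A1 (Suc n) \<theta> (Suc n)) (A2 (Suc n) \<theta> (Suc n))
      (A3 (Suc n) \<theta> (Suc n)) \<beta> t"
    unfolding R_def lin A_Suc_new_pole[OF d pf, folded \<beta>_def] by (simp only: sum.distrib sum_distrib_left)
  define G where "G u = (\<Sum>i=1..n. F i u)" for u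
  have "DERIV G u :> hypoXG_sum n \<theta> (t - u) * xg_kernel \<beta> u" for u
    unfolding G_def hypoXG_sum_def sum_distrib_right exp_poly_def [symmetric]
    by (rule DERIV_sum) (use F in auto)
  moreover have "G t - G 0 = hypoXG_sum (Suc n) \<theta> t"
  proof -
    have "G t - G 0 = (\<Sum>i=1..n. F i t - F i 0)" by (simp add: G_def sum_subtractf)
    also have "\<dots> = (\<Sum>i=1..n. exp_poly (A1 (Suc n) \<theta> i) (A2 (Suc n) \<theta> i) (A3 (Suc n) \<theta> i) (\<theta> i) t)
        + (\<Sum>i=1..n. R i)"
      by (simp add: F sum.distrib)
    also have "\<dots> = hypoXG_sum (Suc n) \<theta> t"
      unfolding R by (simp add: hypoXG_sum_def exp_poly_def \<beta>_def)
    finally show ?thesis .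
  qed
  ultimately show ?thesis unfolding \<beta>_def by blast
qed

section \<open>Positivity on the half-line\<close>

lemma xg_kernel_pos: "\<beta> > 0 \<Longrightarrow> xg_kernel \<beta> u > 0"
  by (simp add: xg_kernel_def add_pos_nonneg)

text \<open>Coefficients may be negative, so positivity is not visible term by term. In the
  induction the sum is the increment over \<open>{0..t}\<close> of a function with positive
  derivative inside.\<close>

lemma hypoXG_sum_pos:
  assumes "distinct_params n \<theta>" "n \<ge> 1"
  shows "t > 0 \<Longrightarrow> hypoXG_sum n \<theta> t > 0" "t \<ge> 0 \<Longrightarrow> hypoXG_sum n \<theta> t \<ge> 0"
proof -
  have "(t > 0 \<longrightarrow> hypoXG_sum n \<theta> t > 0) \<and> (t \<ge> 0 \<longrightarrow> hypoXG_sum n \<theta> t \<ge> 0)"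
    using assms(2,1)
  proof (induction n arbitrary: t rule: dec_induct)
    case base
    then have "\<theta> 1 > 0" by (simp add: distinct_params_def)
    then show ?case unfolding hypoXG_sum_1 using xg_kernel_pos[of "\<theta> 1" t] by simp
  next
    case (step n)
    obtain G where G: "\<And>u. DERIV G u :> hypoXG_sum n \<theta> (t - u) * xg_kernel (\<theta> (Suc n)) u"
      and Gt: "G t - G 0 = hypoXG_sum (Suc n) \<theta> t"
      using hypoXG_sum_convolution[OF step.prems step.hyps(1), of t] by blast
    have "\<theta> (Suc n) > 0" using step.prems by (simp add: distinct_params_def)
    then have pos: "hypoXG_sum n \<theta> (t - u) * xg_kernel (\<theta> (Suc n)) u > 0" if "0 < u" "u < t" for u
      using step.IH[OF distinct_params_Suc[OF step.prems], of "t - u"] that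
      by (simp add: xg_kernel_pos)
    have cont: "continuous_on {0..t} G"
      using G by (meson DERIV_isCont continuous_at_imp_continuous_on)
    have inc: "G 0 < G t" if "t > 0"
    proof (rule DERIV_pos_imp_increasing_open[OF that])
      show "\<exists>y. DERIV G u :> y \<and> y > 0" if "0 < u" "u < t" for u
        using G[of u] pos[OF that] by blast
    qed (rule cont)
    have "hypoXG_sum (Suc n) \<theta> t = 0" if "t = 0"
      using Gt that by simp
    then show ?case using Gt inc by (cases "t = 0") auto
  qed
  then show "t > 0 \<Longrightarrow> hypoXG_sum n \<theta> t > 0" "t \<ge> 0 \<Longrightarrow> hypoXG_sum n \<theta> t \<ge> 0" by auto
qed

section \<open>The density\<close>

definition hypoXG_pdf :: "nat \<Rightarrow> (nat \<Rightarrow> real) \<Rightarrow> real \<Rightarrow> real" where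
  "hypoXG_pdf n \<theta> t = (if t > 0 then K n \<theta> * hypoXG_sum n \<theta> t else 0)"

lemma K_Suc: "K (Suc n) \<theta> = K n \<theta> * ((\<theta> (Suc n))\<^sup>2 / (1 + \<theta> (Suc n)))"
  by (simp add: K_def)

lemma K_pos: "distinct_params n \<theta> \<Longrightarrow> K n \<theta> > 0"
  unfolding K_def
  by (intro prod_pos divide_pos_pos) (use distinct_paramsD(1)[of n \<theta>] in \<open>fastforce intro: add_pos_pos\<close>)+

lemma xgamma_density_eq:
  "xgamma_density \<beta> t = (if t > 0 then \<beta>\<^sup>2 / (1 + \<beta>) * xg_kernel \<beta> t else 0)"
  by (simp add: xgamma_density_def xg_kernel_def)

lemma xgamma_density_nonneg: "\<beta> > 0 \<Longrightarrow> xgamma_density \<beta> t \<ge> 0"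
  by (simp add: xgamma_density_def)

lemma borel_measurable_xgamma_density [measurable]: "xgamma_density \<beta> \<in> borel_measurable borel"
  unfolding xgamma_density_def [abs_def] by measurable

lemma borel_measurable_hypoXG_sum [measurable]: "hypoXG_sum n \<theta> \<in> borel_measurable borel"
  unfolding hypoXG_sum_def [abs_def] by measurable

lemma borel_measurable_hypoXG_pdf [measurable]: "hypoXG_pdf n \<theta> \<in> borel_measurable borel"
  unfolding hypoXG_pdf_def [abs_def] by measurable

lemma hypoXG_pdf_nonneg: "distinct_params n \<theta> \<Longrightarrow> n \<ge> 1 \<Longrightarrow> hypoXG_pdf n \<theta> t \<ge> 0"
  using K_pos[of n \<theta>] hypoXG_sum_pos(2)[of n \<theta> t] by (simp add: hypoXG_pdf_def)

text \<open>An XGamma law is a mixture of an exponential and an Erlang law.\<close>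

lemma prob_space_XG:
  assumes \<beta>: "\<beta> > 0"
  shows "prob_space (XG \<beta>)"
proof
  have erl: "(\<integral>\<^sup>+t. ennreal (erlang_density k \<beta> t) \<partial>lborel) = 1" for k
    using prob_space.emeasure_space_1[OF prob_space_erlang_density[OF \<beta>, of k]]
    by (simp add: emeasure_density)
  have "emeasure (XG \<beta>) (space (XG \<beta>)) = (\<integral>\<^sup>+t. ennreal (xgamma_density \<beta> t) \<partial>lborel)"
    by (simp add: XG_def emeasure_density)
  also have "\<dots> = (\<integral>\<^sup>+t. ennreal (\<beta> / (1 + \<beta>)) * ennreal (erlang_density 0 \<beta> t)
      + ennreal (1 / (1 + \<beta>)) * ennreal (erlang_density 2 \<beta> t) \<partial>lborel)"
  proof (rule nn_integral_cong_AE)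
    \<comment> \<open>At \<open>t = 0\<close> the Erlang density of order 0 is
      \<open>\<beta>\<close>, while \<open>xgamma_density\<close> is 0.\<close>
    show "AE t in lborel. ennreal (xgamma_density \<beta> t) =
        ennreal (\<beta> / (1 + \<beta>)) * ennreal (erlang_density 0 \<beta> t)
      + ennreal (1 / (1 + \<beta>)) * ennreal (erlang_density 2 \<beta> t)"
      using AE_lborel_singleton[of 0]
    proof eventually_elim
      case (elim t)
      have "xgamma_density \<beta> t = \<beta> / (1 + \<beta>) * erlang_density 0 \<beta> t
          + 1 / (1 + \<beta>) * erlang_density 2 \<beta> t"
      proof -
        have "1 + \<beta> \<noteq> 0" using \<beta> by simp
        then show ?thesis
          using elim by (simp add: xgamma_density_def erlang_density_def fact_numeral divide_simps)
            (simp add: algebra_simps power_numeral_reduce)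
      qed
      then show ?case
        using \<beta> by (simp add: ennreal_mult [symmetric] ennreal_plus [symmetric] del: ennreal_plus)
    qed
  qed
  also have "\<dots> = ennreal (\<beta> / (1 + \<beta>)) + ennreal (1 / (1 + \<beta>))"
    by (simp add: nn_integral_add nn_integral_cmult erl)
  also have "\<dots> = 1"
    using \<beta> by (simp add: ennreal_plus [symmetric] add_divide_distrib [symmetric] del: ennreal_plus)
  finally show "emeasure (XG \<beta>) (space (XG \<beta>)) = 1" .
qed

text \<open>The normalizing constants multiply to \<open>K (Suc n) \<theta>\<close>, and the
  substitution \<open>u = x - y\<close> turns the primitive from
  \<open>hypoXG_sum_convolution\<close> into one of the integrand.\<close>

lemma nn_integral_hypoXG_convolution:
  assumes d: "distinct_params (Suc n) \<theta>" and n: "n \<ge> 1"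
  shows "(\<integral>\<^sup>+y. ennreal (xgamma_density (\<theta> (Suc n)) (x - y)) * ennreal (hypoXG_pdf n \<theta> y) \<partial>lborel) =
    ennreal (hypoXG_pdf (Suc n) \<theta> x)"
proof (cases "x > 0")
  case False
  then have z: "ennreal (xgamma_density (\<theta> (Suc n)) (x - y)) * ennreal (hypoXG_pdf n \<theta> y) = 0" for y
    by (auto simp: xgamma_density_def hypoXG_pdf_def)
  show ?thesis unfolding z using False by (simp add: hypoXG_pdf_def)
next
  case True
  note d' = distinct_params_Suc[OF d]
  define \<beta> where "\<beta> = \<theta> (Suc n)"
  have \<beta>: "\<beta> > 0" using d by (simp add: distinct_params_def \<beta>_def)
  define C where "C = K (Suc n) \<theta>"
  have C: "C > 0" "C = K n \<theta> * (\<beta>\<^sup>2 / (1 + \<beta>))"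
    using K_pos[OF d] K_Suc[of n \<theta>] by (auto simp: C_def \<beta>_def)
  obtain G where G: "\<And>u. DERIV G u :> hypoXG_sum n \<theta> (x - u) * xg_kernel \<beta> u"
    and Gx: "G x - G 0 = hypoXG_sum (Suc n) \<theta> x"
    using hypoXG_sum_convolution[OF d n, of x] unfolding \<beta>_def by blast
  define f where "f y = C * (hypoXG_sum n \<theta> y * xg_kernel \<beta> (x - y))" for y
  define F where "F y = - C * G (x - y)" for y
  have "(\<integral>\<^sup>+y. ennreal (xgamma_density \<beta> (x - y)) * ennreal (hypoXG_pdf n \<theta> y) \<partial>lborel) =
      (\<integral>\<^sup>+y. ennreal (f y) * indicator {0..x} y \<partial>lborel)"
  proof (rule nn_integral_cong_AE)
    \<comment> \<open>At both endpoints one of the densities is 0 by definition, whereas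
      \<open>f\<close> need not vanish.\<close>
    show "AE y in lborel. ennreal (xgamma_density \<beta> (x - y)) * ennreal (hypoXG_pdf n \<theta> y) =
        ennreal (f y) * indicator {0..x} y"
      using AE_lborel_singleton[of 0] AE_lborel_singleton[of x]
    proof eventually_elim
      case (elim y)
      have "xgamma_density \<beta> (x - y) * hypoXG_pdf n \<theta> y = f y * indicator {0..x} y"
        using elim unfolding C(2) f_def
        by (auto simp: xgamma_density_eq hypoXG_pdf_def indicator_def)
      moreover have "ennreal (f y) * indicator {0..x} y = ennreal (f y * indicator {0..x} y)"
        by (simp add: indicator_def)
      ultimately show ?case
        using xgamma_density_nonneg[OF \<beta>, of "x - y"] hypoXG_pdf_nonneg[OF d' n, of y]
        by (simp add: ennreal_mult [symmetric])
    qed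
  qed
  also have "\<dots> = ennreal (F x - F 0)"
  proof (rule nn_integral_FTC_Icc)
    show "f \<in> borel_measurable borel"
      unfolding f_def [abs_def] xg_kernel_def by measurable
    show "DERIV F y :> f y" for y
      unfolding F_def [abs_def] f_def
      by (auto intro!: derivative_eq_intros DERIV_chain2[OF G])
    show "0 \<le> f y" if "y \<in> {0..x}" for y
      using that C(1) hypoXG_sum_pos(2)[OF d' n, of y] xg_kernel_pos[OF \<beta>, of "x - y"]
      by (simp add: f_def)
  qed (use True in simp)
  also have "F x - F 0 = C * (G x - G 0)"
    by (simp add: F_def algebra_simps)
  also have "\<dots> = hypoXG_pdf (Suc n) \<theta> x"
    unfolding Gx using True by (simp add: hypoXG_pdf_def C_def)
  finally show ?thesis by (simp add: \<beta>_def)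
qed

section \<open>The law of the sum\<close>

lemma (in prob_space) distributed_hypoXG:
  fixes X :: "nat \<Rightarrow> 'a \<Rightarrow> real"
  assumes "n \<ge> 1" and "distinct_params n \<theta>"
    and "indep_vars (\<lambda>_. borel) X {1..n}"
    and "\<And>j. j \<in> {1..n} \<Longrightarrow> distributed M lborel (X j) (\<lambda>t. ennreal (xgamma_density (\<theta> j) t))"
  shows "distributed M lborel (\<lambda>\<omega>. \<Sum>j=1..n. X j \<omega>) (\<lambda>t. ennreal (hypoXG_pdf n \<theta> t))"
  using assms
proof (induction n rule: dec_induct)
  case base
  have "\<theta> 1 > 0" using base.prems(1) by (simp add: distinct_params_def)
  then have "xgamma_density (\<theta> 1) = hypoXG_pdf 1 \<theta>"
    unfolding hypoXG_pdf_def [abs_def] hypoXG_sum_1 by (auto simp: xgamma_density_eq K_def)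
  then show ?case using base.prems(3)[of 1] by simp
next
  case (step n)
  have set: "{1..Suc n} = insert (Suc n) {1..n}" by auto
  have "indep_var borel (X (Suc n)) borel (\<lambda>\<omega>. \<Sum>j=1..n. X j \<omega>)"
    using step.prems(2) unfolding set by (intro indep_vars_sum) auto
  moreover have "distributed M lborel (\<lambda>\<omega>. \<Sum>j=1..n. X j \<omega>) (\<lambda>t. ennreal (hypoXG_pdf n \<theta> t))"
    using step.prems(3)
    by (intro step.IH distinct_params_Suc[OF step.prems(1)] indep_vars_subset[OF step.prems(2)]) auto
  ultimately have "distributed M lborel (\<lambda>\<omega>. X (Suc n) \<omega> + (\<Sum>j=1..n. X j \<omega>))
      (\<lambda>x. \<integral>\<^sup>+y. ennreal (xgamma_density (\<theta> (Suc n)) (x - y)) * ennreal (hypoXG_pdf n \<theta> y) \<partial>lborel)"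
    by (intro distributed_convolution step.prems(3)) auto
  then show ?case
    unfolding nn_integral_hypoXG_convolution[OF step.prems(1) step.hyps(1)]
    by (simp add: add.commute)
qed

lemma sets_XG [simp, measurable_cong]: "sets (XG \<theta>) = sets borel"
  by (simp add: XG_def)

text \<open>The coordinate maps of the product space are independent with the XGamma laws, so
  \<open>distributed_hypoXG\<close> applies to their sum.\<close>

lemma HypoXG_eq_density:
  assumes d: "distinct_params n \<theta>" and n: "n \<ge> 1"
  shows "HypoXG n \<theta> = density lborel (\<lambda>t. ennreal (hypoXG_pdf n \<theta> t))"
proof -
  let ?M = "PiM {1..n} (\<lambda>j. XG (\<theta> j))"
  have ps: "prob_space (XG (\<theta> j))" if "j \<in> {1..n}" for j
    using distinct_paramsD(1)[OF d that] by (rule prob_space_XG)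
  interpret prob_space ?M by (rule prob_space_PiM[OF ps])
  have rv [measurable]: "(\<lambda>\<omega>. \<omega> j) \<in> borel_measurable ?M" if "j \<in> {1..n}" for j
    using measurable_component_singleton[OF that, of "\<lambda>j. XG (\<theta> j)"] by (simp cong: measurable_cong_sets)
  have law: "distr ?M borel (\<lambda>\<omega>. \<omega> j) = XG (\<theta> j)" if "j \<in> {1..n}" for j
  proof -
    have "distr ?M borel (\<lambda>\<omega>. \<omega> j) = distr ?M (XG (\<theta> j)) (\<lambda>\<omega>. \<omega> j)"
      by (rule distr_cong) auto
    then show ?thesis using distr_PiM_component[OF ps that] by simp
  qed
  have sets: "sets (PiM {1..n} (\<lambda>_. borel :: real measure)) = sets ?M"
    by (rule sets_PiM_cong) auto
  have "distr ?M (PiM {1..n} (\<lambda>_. borel)) (\<lambda>\<omega>. \<lambda>j\<in>{1..n}. \<omega> j) = distr ?M ?M (\<lambda>\<omega>. \<omega>)"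
    by (rule distr_cong[OF refl sets]) (auto simp: space_PiM PiE_restrict)
  also have "\<dots> = PiM {1..n} (\<lambda>j. distr ?M borel (\<lambda>\<omega>. \<omega> j))"
    unfolding distr_id by (intro PiM_cong refl law [symmetric])
  finally have indep: "indep_vars (\<lambda>_. borel) (\<lambda>j \<omega>. \<omega> j) {1..n}"
    using n rv by (subst indep_vars_iff_distr_eq_PiM') auto
  have "distributed ?M lborel (\<lambda>\<omega>. \<omega> j) (\<lambda>t. ennreal (xgamma_density (\<theta> j) t))"
    if "j \<in> {1..n}" for j
  proof -
    have "distr ?M lborel (\<lambda>\<omega>. \<omega> j) = distr ?M borel (\<lambda>\<omega>. \<omega> j)"
      by (rule distr_cong) auto
    then show ?thesis using law[OF that] rv[OF that] by (simp add: distributed_def XG_def)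
  qed
  from distributed_hypoXG[OF n d indep this]
  have "distr ?M lborel (\<lambda>\<omega>. \<Sum>j=1..n. \<omega> j) = density lborel (\<lambda>t. ennreal (hypoXG_pdf n \<theta> t))"
    by (simp add: distributed_def)
  moreover have "distr ?M lborel (\<lambda>\<omega>. \<Sum>j=1..n. \<omega> j) = HypoXG n \<theta>"
    unfolding HypoXG_def by (rule distr_cong) auto
  ultimately show ?thesis by simp
qed

lemma hypoXG_density_eq:
  assumes "distinct_params n \<theta>" and "n \<ge> 1"
  shows "hypoXG_density n \<theta> = hypoXG_pdf n \<theta>"
proof -
  have "continuous_on {0<..} (hypoXG_sum n \<theta>)"
    unfolding hypoXG_sum_def [abs_def] by (intro continuous_intros) auto
  then have "continuous_on {0<..} (\<lambda>t. K n \<theta> * hypoXG_sum n \<theta> t)"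
    by (intro continuous_intros)
  then have "continuous_on {0<..} (hypoXG_pdf n \<theta>)"
    by (rule continuous_on_eq) (simp add: hypoXG_pdf_def)
  then have "is_hypoXG_density n \<theta> (hypoXG_pdf n \<theta>)"
    unfolding is_hypoXG_density_def
    using hypoXG_pdf_nonneg[OF assms] HypoXG_eq_density[OF assms]
    by (auto simp: hypoXG_pdf_def)
  then show ?thesis
    unfolding hypoXG_density_def by (blast intro: is_hypoXG_density_unique)
qed

section \<open>The likelihood equation\<close>

lemma real_differentiable_prod:
  fixes f :: "'a \<Rightarrow> real \<Rightarrow> real"
  assumes "\<And>i. i \<in> I \<Longrightarrow> f i differentiable (at x)"
  shows "(\<lambda>x. \<Prod>i\<in>I. f i x) differentiable (at x)"
  using assms by (induction I rule: infinite_finite_induct) auto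

text \<open>Letting every coordinate depend on one real variable treats together the cases that the
  varied parameter is \<open>\<theta> i\<close> itself or another one. Distinctness and positivity
  at \<open>x\<close> keep the denominators nonzero.\<close>

lemma A_differentiable:
  fixes e :: "nat \<Rightarrow> real \<Rightarrow> real"
  assumes e: "\<And>j. j \<in> {1..n} \<Longrightarrow> e j differentiable (at x)"
    and d: "distinct_params n (\<lambda>j. e j x)" and i: "i \<in> {1..n}"
  shows "(\<lambda>x. A1 n (\<lambda>j. e j x) i) differentiable (at x)"
    and "(\<lambda>x. A2 n (\<lambda>j. e j x) i) differentiable (at x)"
    and "(\<lambda>x. A3 n (\<lambda>j. e j x) i) differentiable (at x)"
proof -
  have ei: "e i differentiable (at x)" "e i x \<noteq> 0"
    using e i distinct_paramsD(1)[OF d i] by auto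
  have j: "e j differentiable (at x)" "e j x - e i x \<noteq> 0" "(e j x - e i x)\<^sup>2 + e j x \<noteq> 0"
    "((e j x - e i x)\<^sup>2 + e j x)\<^sup>2 \<noteq> 0" "(e j x - e i x) ^ k \<noteq> 0"
    if "j \<in> {1..n} - {i}" for j k
  proof -
    show "e j differentiable (at x)" using e that by simp
    show ne: "e j x - e i x \<noteq> 0"
      using distinct_paramsD(2)[OF d, of j i] i that by auto
    show "(e j x - e i x)\<^sup>2 + e j x \<noteq> 0"
      using distinct_paramsD(1)[OF d, of j] that
      by (intro less_imp_neq[symmetric] add_nonneg_pos) auto
    then show "((e j x - e i x)\<^sup>2 + e j x)\<^sup>2 \<noteq> 0" by simp
    show "(e j x - e i x) ^ k \<noteq> 0" using ne by simp
  qed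
  note intros = differentiable_add differentiable_mult differentiable_diff differentiable_divide
    differentiable_power differentiable_const differentiable_sum real_differentiable_prod
    finite_Diff finite_atLeastAtMost ei j
  show 1: "(\<lambda>x. A1 n (\<lambda>j. e j x) i) differentiable (at x)"
    unfolding A1_def by (intro intros)
  have S: "(\<lambda>x. \<Sum>j\<in>{1..n} - {i}. 2 * (e j x - e i x) / ((e j x - e i x)\<^sup>2 + e j x)
      - 3 / (e j x - e i x)) differentiable (at x)"
    by (intro intros ballI)
  have S': "(\<lambda>x. \<Sum>j\<in>{1..n} - {i}. - 2 * (((e j x - e i x)\<^sup>2 - e j x) / ((e j x - e i x)\<^sup>2 + e j x)\<^sup>2)
      + 3 / (e j x - e i x)\<^sup>2) differentiable (at x)"
    by (intro intros ballI)
  show "(\<lambda>x. A2 n (\<lambda>j. e j x) i) differentiable (at x)"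
    unfolding A2_def by (intro differentiable_mult 1 S)
  show "(\<lambda>x. A3 n (\<lambda>j. e j x) i) differentiable (at x)"
    unfolding A3_def
    by (intro differentiable_add differentiable_mult differentiable_divide differentiable_power
        differentiable_const 1 S S' ei) auto
qed

lemma DERIV_ln_K_update:
  assumes d: "distinct_params n \<theta>" and p: "p \<in> {1..n}"
  shows "DERIV (\<lambda>x. ln (K n (\<theta>(p := x)))) (\<theta> p) :> (2 + \<theta> p) / (\<theta> p * (1 + \<theta> p))"
proof -
  define C where "C = (\<Prod>i\<in>{1..n} - {p}. (\<theta> i)\<^sup>2 / (1 + \<theta> i))"
  have K: "K n (\<theta>(p := x)) = x\<^sup>2 / (1 + x) * C" for x
  proof -
    have "K n (\<theta>(p := x)) = x\<^sup>2 / (1 + x) * (\<Prod>i\<in>{1..n} - {p}. ((\<theta>(p := x)) i)\<^sup>2 / (1 + (\<theta>(p := x)) i))"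
      unfolding K_def using p by (subst prod.remove[of _ p]) auto
    also have "(\<Prod>i\<in>{1..n} - {p}. ((\<theta>(p := x)) i)\<^sup>2 / (1 + (\<theta>(p := x)) i)) = C"
      unfolding C_def by (rule prod.cong) auto
    finally show ?thesis .
  qed
  have \<theta>: "\<theta> p > 0" using distinct_paramsD(1)[OF d p] .
  have "K n \<theta> > 0" using K_pos[OF d] .
  then have C: "C > 0" using K[of "\<theta> p"] \<theta> by (simp add: zero_less_mult_iff zero_less_divide_iff)
  have "DERIV (\<lambda>x. 2 * ln x - ln (1 + x) + ln C) (\<theta> p) :> 2 / \<theta> p - 1 / (1 + \<theta> p)"
    using \<theta> by (auto intro!: derivative_eq_intros simp: divide_inverse)
  also have "2 / \<theta> p - 1 / (1 + \<theta> p) = (2 + \<theta> p) / (\<theta> p * (1 + \<theta> p))"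
    using \<theta> by (simp add: field_simps)
  finally have *: "DERIV (\<lambda>x. 2 * ln x - ln (1 + x) + ln C) (\<theta> p) :> (2 + \<theta> p) / (\<theta> p * (1 + \<theta> p))" .
  \<comment> \<open>The logarithm splits in this way for \<open>x > 0\<close>, an open set around
    \<open>\<theta> p\<close>.\<close>
  show ?thesis
    by (rule has_field_derivative_transform_within_open[OF *, of "{0<..}"])
      (use \<theta> C in \<open>auto simp: K ln_mult ln_div ln_realpow\<close>)
qed

text \<open>\<open>deriv\<close> yields an actual derivative once the function is differentiable, so
  the content is the differentiability of each term.\<close>

lemma DERIV_hypoXG_sum_update:
  assumes d: "distinct_params n \<theta>" and p: "p \<in> {1..n}"
  shows "DERIV (\<lambda>x. hypoXG_sum n (\<theta>(p := x)) t) (\<theta> p) :>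
    (\<Sum>i=1..n. partial_deriv p
       (\<lambda>\<eta>. exp (- \<eta> i * t) * (A1 n \<eta> i * t\<^sup>2 / 2 + A2 n \<eta> i * t + A3 n \<eta> i)) \<theta>)"
proof -
  define e where "e j x = (\<theta>(p := x)) j" for j x
  have e_upd: "\<theta>(p := x) = (\<lambda>j. e j x)" for x by (simp add: e_def fun_upd_def)
  have e: "e j differentiable (at x)" for j x
    unfolding e_def [abs_def] by (cases "j = p") auto
  have d': "distinct_params n (\<lambda>j. e j (\<theta> p))" using d by (simp add: e_def fun_upd_triv)
  show ?thesis
    unfolding hypoXG_sum_def partial_deriv_def
  proof (rule DERIV_sum)
    fix i assume i: "i \<in> {1..n}"
    note A = A_differentiable[OF e d' i]
    have "(\<lambda>x. - e i x * t) differentiable (at (\<theta> p))"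
      by (intro differentiable_mult differentiable_minus e differentiable_const)
    then have "(\<lambda>x. exp (- e i x * t)) differentiable (at (\<theta> p))"
      unfolding real_differentiable_def using DERIV_fun_exp[of "\<lambda>x. - e i x * t"] by metis
    then have "(\<lambda>x. exp (- e i x * t) * (A1 n (\<lambda>j. e j x) i * t\<^sup>2 / 2 + A2 n (\<lambda>j. e j x) i * t
        + A3 n (\<lambda>j. e j x) i)) differentiable (at (\<theta> p))"
      by (intro differentiable_mult differentiable_add differentiable_divide differentiable_const A) auto
    then show "DERIV (\<lambda>x. exp (- (\<theta>(p := x)) i * t) * (A1 n (\<theta>(p := x)) i * t\<^sup>2 / 2
        + A2 n (\<theta>(p := x)) i * t + A3 n (\<theta>(p := x)) i)) (\<theta> p) :>
      deriv (\<lambda>x. exp (- (\<theta>(p := x)) i * t) * (A1 n (\<theta>(p := x)) i * t\<^sup>2 / 2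
        + A2 n (\<theta>(p := x)) i * t + A3 n (\<theta>(p := x)) i)) (\<theta> p)"
      unfolding e_upd DERIV_deriv_iff_real_differentiable .
  qed
qed

section \<open>The log-likelihood and its maximizers\<close>

lemma likelihood_eq:
  assumes "distinct_params n \<theta>" "n \<ge> 1" "\<And>u. u \<in> {1..N} \<Longrightarrow> t u > 0"
  shows "likelihood n N t \<theta> > 0"
    and "ln (likelihood n N t \<theta>) = (\<Sum>u=1..N. ln (K n \<theta>) + ln (hypoXG_sum n \<theta> (t u)))"
proof -
  have L: "likelihood n N t \<theta> = (\<Prod>u=1..N. K n \<theta> * hypoXG_sum n \<theta> (t u))"
    unfolding likelihood_def hypoXG_density_eq[OF assms(1,2)]
    by (rule prod.cong) (use assms(3) in \<open>auto simp: hypoXG_pdf_def\<close>)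
  have pos: "K n \<theta> > 0" "hypoXG_sum n \<theta> (t u) > 0" if "u \<in> {1..N}" for u
    using K_pos hypoXG_sum_pos(1) assms that by auto
  show "likelihood n N t \<theta> > 0"
    unfolding L by (intro prod_pos mult_pos_pos pos)
  have "ln (likelihood n N t \<theta>) = (\<Sum>u=1..N. ln (K n \<theta> * hypoXG_sum n \<theta> (t u)))"
    unfolding L by (rule ln_prod) (use pos in force)+
  also have "\<dots> = (\<Sum>u=1..N. ln (K n \<theta>) + ln (hypoXG_sum n \<theta> (t u)))"
    by (rule sum.cong) (use pos in \<open>auto simp: ln_mult_pos\<close>)
  finally show "ln (likelihood n N t \<theta>) = (\<Sum>u=1..N. ln (K n \<theta>) + ln (hypoXG_sum n \<theta> (t u)))" .
qed

text \<open>The admissible values of one coordinate form the positive half-line without finitely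
  many points, an open set.\<close>

lemma distinct_params_update_nhd:
  assumes d: "distinct_params n \<theta>" and p: "p \<in> {1..n}"
  obtains \<epsilon> where "\<epsilon> > 0" "\<And>x. \<bar>\<theta> p - x\<bar> < \<epsilon> \<Longrightarrow> distinct_params n (\<theta>(p := x))"
proof -
  define U where "U = {0<..} - \<theta> ` ({1..n} - {p})"
  have "open U" unfolding U_def by (intro open_Diff open_greaterThan finite_imp_closed) auto
  moreover have "\<theta> p \<in> U"
    using d p by (auto simp: U_def distinct_params_def dest: inj_onD)
  ultimately obtain \<epsilon> where \<epsilon>: "\<epsilon> > 0" "ball (\<theta> p) \<epsilon> \<subseteq> U"
    using openE by blast
  have "distinct_params n (\<theta>(p := x))" if "x \<in> U" for x
  proof -
    have ne: "x \<noteq> \<theta> j" if "j \<in> {1..n}" "j \<noteq> p" for j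
      using \<open>x \<in> U\<close> that by (auto simp: U_def)
    have "inj_on (\<theta>(p := x)) {1..n}"
    proof (rule inj_onI)
      fix i j assume ij: "i \<in> {1..n}" "j \<in> {1..n}" "(\<theta>(p := x)) i = (\<theta>(p := x)) j"
      then show "i = j"
        using ne[of i] ne[of j] distinct_paramsD(2)[OF d, of i j]
        by (cases "i = p"; cases "j = p") auto
    qed
    then show ?thesis using d that by (simp add: distinct_params_def U_def)
  qed
  then show ?thesis
    using \<epsilon> by (intro that[of \<epsilon>]) (auto simp: subset_eq dist_real_def)
qed

text \<open>Along coordinate \<open>p\<close> the log-likelihood has a local maximum at the
  estimator, so its derivative is 0. The constant \<open>K\<close> enters once per observation,
  hence the factor \<open>N\<close>.\<close>

lemma likelihood_equation:
  assumes t_pos: "\<And>u. u \<in> {1..N} \<Longrightarrow> t u > 0"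
    and mle: "is_MLE n N t \<theta>"
    and p: "p \<in> {1..n}"
  shows "real N * (2 + \<theta> p) / (\<theta> p * (1 + \<theta> p))
        + (\<Sum>u=1..N.
            (\<Sum>i=1..n. partial_deriv p
               (\<lambda>\<eta>. exp (- \<eta> i * t u) * (A1 n \<eta> i * (t u)\<^sup>2 / 2 + A2 n \<eta> i * t u + A3 n \<eta> i)) \<theta>)
          / hypoXG_sum n \<theta> (t u)) = 0"
proof -
  have n: "n \<ge> 1" using p by simp
  have d: "distinct_params n \<theta>" and max: "\<And>\<eta>. distinct_params n \<eta> \<Longrightarrow>
      likelihood n N t \<eta> \<le> likelihood n N t \<theta>"
    using mle unfolding is_MLE_def is_arg_max_linorder by auto
  obtain \<epsilon> where \<epsilon>: "\<epsilon> > 0" and near: "\<And>x. \<bar>\<theta> p - x\<bar> < \<epsilon> \<Longrightarrow> distinct_params n (\<theta>(p := x))"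
    using distinct_params_update_nhd[OF d p] by blast
  define l where "l x = (\<Sum>u=1..N. ln (K n (\<theta>(p := x))) + ln (hypoXG_sum n (\<theta>(p := x)) (t u)))" for x
  define D where "D u = (\<Sum>i=1..n. partial_deriv p
      (\<lambda>\<eta>. exp (- \<eta> i * t u) * (A1 n \<eta> i * (t u)\<^sup>2 / 2 + A2 n \<eta> i * t u + A3 n \<eta> i)) \<theta>)" for u
  have "DERIV l (\<theta> p) :> (\<Sum>u=1..N. (2 + \<theta> p) / (\<theta> p * (1 + \<theta> p)) + D u / hypoXG_sum n \<theta> (t u))"
    unfolding l_def
  proof (rule DERIV_sum)
    fix u assume "u \<in> {1..N}"
    then have "hypoXG_sum n \<theta> (t u) > 0" using hypoXG_sum_pos(1)[OF d n] t_pos by blast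
    then have "DERIV (\<lambda>x. ln (hypoXG_sum n (\<theta>(p := x)) (t u))) (\<theta> p) :>
        1 / hypoXG_sum n \<theta> (t u) * D u"
      using DERIV_chain2[OF DERIV_ln_divide DERIV_hypoXG_sum_update[OF d p, of "t u"]]
      unfolding D_def by (simp add: fun_upd_triv)
    then show "DERIV (\<lambda>x. ln (K n (\<theta>(p := x))) + ln (hypoXG_sum n (\<theta>(p := x)) (t u))) (\<theta> p) :>
        (2 + \<theta> p) / (\<theta> p * (1 + \<theta> p)) + D u / hypoXG_sum n \<theta> (t u)"
      using DERIV_add[OF DERIV_ln_K_update[OF d p]] by simp
  qed
  moreover have "l x \<le> l (\<theta> p)" if "\<bar>\<theta> p - x\<bar> < \<epsilon>" for x
  proof -
    have "l x = ln (likelihood n N t (\<theta>(p := x)))" "l (\<theta> p) = ln (likelihood n N t \<theta>)"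
      using likelihood_eq(2)[where t = t and N = N, OF near[OF that] n t_pos] likelihood_eq(2)[where t = t and N = N, OF d n t_pos]
      by (simp_all add: l_def)
    then show ?thesis
      using max[OF near[OF that]] likelihood_eq(1)[where t = t and N = N, OF near[OF that] n t_pos] by simp
  qed
  ultimately have "(\<Sum>u=1..N. (2 + \<theta> p) / (\<theta> p * (1 + \<theta> p)) + D u / hypoXG_sum n \<theta> (t u)) = 0"
    using DERIV_local_max[OF _ \<epsilon>] by blast
  then show ?thesis by (simp add: sum.distrib D_def)
qed

text \<open>The numerator is the derivative from \<open>likelihood_equation\<close>, the same for
  every \<open>v\<close>. So each quotient is 0, also at a vanishing denominator, where division
  yields 0.\<close>

theorem theorem3p1:
  fixes n N p :: nat and t \<theta> :: "nat \<Rightarrow> real"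
  assumes t_pos: "\<And>u. u \<in> {1..N} \<Longrightarrow> t u > 0"
    and mle: "is_MLE n N t \<theta>"
    and p: "p \<in> {1..n}"
  shows "(\<Sum>v=1..N.
      (real N * (2 + \<theta> p) / (\<theta> p * (1 + \<theta> p))
        + (\<Sum>u=1..N.
            (\<Sum>i=1..n. partial_deriv p
               (\<lambda>\<eta>. exp (- \<eta> i * t u) * (A1 n \<eta> i * (t u)\<^sup>2 / 2 + A2 n \<eta> i * t u + A3 n \<eta> i)) \<theta>)
          / (\<Sum>i=1..n. exp (- \<theta> i * t u) * (A1 n \<theta> i * (t u)\<^sup>2 / 2 + A2 n \<theta> i * t u + A3 n \<theta> i))))
      / ((\<Sum>u=1..N. ln (K n \<theta>))
        + (\<Sum>u=1..N. ln (\<Sum>i=1..n.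
              A1 n \<theta> i / \<theta> i ^ 3 * (\<theta> i ^ 3 * (t u)\<^sup>2 * exp (- \<theta> i * t u) / 2)
            + A2 n \<theta> i / (\<theta> i)\<^sup>2 * ((\<theta> i)\<^sup>2 * t u * exp (- \<theta> i * t u))
            + A3 n \<theta> i / \<theta> i * (\<theta> i * exp (- \<theta> i * t u)))))) = 0"
  by (subst likelihood_equation[where t = t and N = N, OF _ mle p, unfolded hypoXG_sum_def])
    (simp_all add: t_pos)

end
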